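(* Let $0<L\le U$, $\theta=U/L$, let $k\ge 1$ be an integer, and consider the problem ROS-$(\delta,\Delta)$ with $\delta=1$ and any price-change cap $\Delta\in\{0,1,\dots,k-1\}$. Let $\{q_j\}_{j\in[\Delta+1]}$ be any reservation vector satisfying $q_1\le q_2\le\dots\le q_{\Delta+1}$ and $\sum_{j=1}^{\Delta+1}q_j=k$. Put $\alpha^\star=1+\ln\theta$, and for every $j\in[\Delta+1]$ and $x\in[0,1]$ write $z_j(x)=\frac{1}{k}\left(\sum_{l=1}^{j-1}q_l+q_jx\right)$ and let $$\phi_j(x)=\begin{cases}L & \text{if } z_j(x)\in[0,\tfrac1{\alpha^\star}),\\ L\cdot\exp\left(\alpha^\star z_j(x)-1\right) & \text{if } z_j(x)\in[\tfrac1{\alpha^\star},1].\end{cases}$$ Then the mechanism cPPM-$\boldsymbol\phi$ with pricing functions $\boldsymbol\phi=\{\phi_j\}_{j\in[\Delta+1]}$ and reservation vector $\{q_j\}$ is $\alpha^\star$-competitive, i.e. $\mathsf{CVaR}_1\text{-CR}(\text{cPPM-}\boldsymbol\phi)\le\alpha^\star$.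
   Context: Problem ROS-$(\delta,\Delta)$ (with $\delta\in(0,1]$, $\Delta\in\{0,\dots,k-1\}$): a seller has $k$ identical units. Buyers $t=1,\dots,T$ arrive one by one; buyer $t$ has a private value $v_t\in[L,U]$, where $0<L\le U$ are known ($\theta=U/L$). When buyer $t$ arrives the seller posts a price $p_t$; if units remain, the buyer accepts and buys one unit ($x_t=1$) if $v_t\ge p_t$ and otherwise leaves ($x_t=0$). At most $k$ units can be sold. Prices are chosen (possibly at random) without knowing the future values or $T$, and must satisfy $\sum_{t=1}^{T-1}\mathbf 1\{p_t\ne p_{t+1}\}\le\Delta$. For an instance $I=(v_1,\dots,v_T)$, $\mathrm{ALG}(I,P)=\sum_t v_tx_t$ is the (random) social welfare, and $\mathrm{OPT}(I)$ is the sum of the $k$ highest values in $I$ (all values if $T<k$). $\mathsf{CVaR}_\delta[X]=\sup_{\tau\in\mathbb R}\{\tau-\frac1\delta\mathbb E[(\tau-X)_+]\}$, where $(x)_+=\max\{x,0\}$; in particular $\mathsf{CVaR}_1[X]=\mathbb E[X]$ for the bounded random variables considered here. $\mathsf{CVaR}_\delta\text{-CR}(\mathrm{ALG})=\sup_I \mathrm{OPT}(I)/\mathsf{CVaR}_\delta[\mathrm{ALG}(I,P)]$, the supremum being over all instances (any $T\ge1$, any values in $[L,U]$). Mechanism cPPM-$\boldsymbol\phi$: the input is pricing functions $\phi_1,\dots,\phi_{\Delta+1}$ on $[0,1]$ and a reservation vector $q_1,\dots,q_{\Delta+1}$ of nonnegative integers summing to $k$. Draw a single seed $R$ uniformly from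 $[0,1]$ and set $y_1=0$. For each buyer $t$, if $y_t<k$: let $j_t=\max\{j\in[\Delta+1]: y_t\ge\sum_{l=1}^{j-1}q_l\}$, post $p_t=\phi_{j_t}(R)$, set $x_t=1$ if $v_t\ge p_t$ and $x_t=0$ otherwise, and $y_{t+1}=y_t+x_t$. If $y_t=k$, nothing more is sold. Notation: $[n]=\{1,\dots,n\}$. *)

theory Defs
  imports "HOL-Probability.Probability"
begin

definition instances :: "real \<Rightarrow> real \<Rightarrow> real list set" where
  "instances L U = {I. I \<noteq> [] \<and> set I \<subseteq> {L..U}}"

definition OPT :: "nat \<Rightarrow> real list \<Rightarrow> real" where
  "OPT k I = sum_list (take k (rev (sort I)))"

text \<open>The supremum is taken in the extended reals, since the supremum of an unbounded set of
  reals is unspecified.\<close>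

definition CVaR :: "real \<Rightarrow> 'a measure \<Rightarrow> ('a \<Rightarrow> real) \<Rightarrow> ereal" where
  "CVaR \<delta> M X =
     (SUP \<tau>::real. ereal (\<tau> - 1 / \<delta> * (\<integral>\<omega>. max 0 (\<tau> - X \<omega>) \<partial>M)))"

text \<open>A mechanism is given by the random welfare \<open>ALG I\<close> that it obtains on each instance \<open>I\<close>,
  a random variable on the probability space \<open>M\<close> of its seeds. In \<open>ereal\<close>, a positive number
  divided by \<open>0\<close> is \<open>\<infinity>\<close>, so a mechanism that earns nothing on some instance has infinite ratio.\<close>

definition CVaR_CR ::
  "real \<Rightarrow> real \<Rightarrow> real \<Rightarrow> nat \<Rightarrow> 'a measure \<Rightarrow> (real list \<Rightarrow> 'a \<Rightarrow> real) \<Rightarrow> ereal" where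
  "CVaR_CR \<delta> L U k M ALG = (SUP I\<in>instances L U. ereal (OPT k I) / CVaR \<delta> M (ALG I))"

text \<open>Pricing functions and reservation vectors are functions on \<open>nat\<close> of which only the
  values at \<open>1, \<dots>, \<Delta> + 1\<close> are used.\<close>

definition cPPM_index :: "nat \<Rightarrow> (nat \<Rightarrow> nat) \<Rightarrow> nat \<Rightarrow> nat" where
  "cPPM_index \<Delta> q y = Max {j \<in> {1..\<Delta> + 1}. y \<ge> (\<Sum>l\<in>{1..<j}. q l)}"

text \<open>The welfare collected from the remaining buyers when \<open>y\<close> units have been sold before and
  the seed is \<open>r\<close>.\<close>

fun cPPM_from ::
  "nat \<Rightarrow> nat \<Rightarrow> (nat \<Rightarrow> real \<Rightarrow> real) \<Rightarrow> (nat \<Rightarrow> nat) \<Rightarrow> real \<Rightarrow> nat \<Rightarrow> real list \<Rightarrow> real" where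
  "cPPM_from k \<Delta> \<phi> q r y [] = 0"
| "cPPM_from k \<Delta> \<phi> q r y (v # vs) =
     (if y < k \<and> v \<ge> \<phi> (cPPM_index \<Delta> q y) r
      then v + cPPM_from k \<Delta> \<phi> q r (Suc y) vs
      else cPPM_from k \<Delta> \<phi> q r y vs)"

definition cPPM ::
  "nat \<Rightarrow> nat \<Rightarrow> (nat \<Rightarrow> real \<Rightarrow> real) \<Rightarrow> (nat \<Rightarrow> nat) \<Rightarrow> real list \<Rightarrow> real \<Rightarrow> real" where
  "cPPM k \<Delta> \<phi> q I r = cPPM_from k \<Delta> \<phi> q r 0 I"

definition seed :: "real measure" where
  "seed = uniform_measure lborel {0..1}"

definition z :: "nat \<Rightarrow> (nat \<Rightarrow> nat) \<Rightarrow> nat \<Rightarrow> real \<Rightarrow> real" where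
  "z k q j x = 1 / real k * (real (\<Sum>l\<in>{1..<j}. q l) + real (q j) * x)"

definition \<alpha>_star :: "real \<Rightarrow> real \<Rightarrow> real" where
  "\<alpha>_star L U = 1 + ln (U / L)"

text \<open>For \<open>j \<in> {1..\<Delta> + 1}\<close> and \<open>x \<in> {0..1}\<close> the value \<open>z k q j x\<close> lies in \<open>{0..1}\<close>, so that
  the case distinction covers the whole domain.\<close>

definition \<phi>_star :: "real \<Rightarrow> real \<Rightarrow> nat \<Rightarrow> (nat \<Rightarrow> nat) \<Rightarrow> nat \<Rightarrow> real \<Rightarrow> real" where
  "\<phi>_star L U k q j x =
     (if z k q j x < 1 / \<alpha>_star L U then L
      else L * exp (\<alpha>_star L U * z k q j x - 1))"

end

theory Submission
  imports Defs
begin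

text \<open>All seeds sell along one increasing price curve on \<open>[0, 1]\<close>; a uniform seed spreads the
  \<open>k\<close> units uniformly over the curve. Let \<open>Z\<close> be the infimum, over the seeds that are not sold
  out at the end, of the position of the next unit. Every seed sells all its units below \<open>Z\<close>;
  at the curve's prices these are worth \<open>k price(Z) / \<alpha>\<close> on average. Because the batch sizes increase,
  at every time the next units of the seeds lie in adjacent batches and are ordered as the
  positions are, so a buyer of value \<open>v\<close> who is refused by some seed is served by every seed that has
  a unit between \<open>Z\<close> and the position where the price is \<open>v\<close>. This happens with probability at
  least \<open>(1 - price(Z) / v) / \<alpha>\<close>. Both contributions add up to the bound
  \<open>OPT \<le> k price(Z) + \<Sum> (v - price(Z))\<^sub>+\<close> divided by \<open>\<alpha>\<close>. If \<open>Z\<close> lies in the flat part of the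
  curve, \<open>Z = 1 / \<alpha>\<close> is used instead, with the \<open>n < k\<close> buyers in place of the \<open>k\<close> units.\<close>

section \<open>Price curve, batches of units and the sales process\<close>

locale price_curve =
  fixes L U :: real and k \<Delta> :: nat and q :: "nat \<Rightarrow> nat"
  assumes L_pos: "0 < L" and L_le_U: "L \<le> U"
    and k_pos: "k \<ge> 1"
    and q_mono: "\<And>i j. i \<in> {1..\<Delta> + 1} \<Longrightarrow> j \<in> {1..\<Delta> + 1} \<Longrightarrow> i \<le> j \<Longrightarrow> q i \<le> q j"
    and q_sum: "(\<Sum>j\<in>{1..\<Delta> + 1}. q j) = k"
begin

definition a :: real where "a = \<alpha>_star L U"

text \<open>All pricing functions are this one curve composed with the affine maps
  \<open>pos j\<close>. Both branches give \<open>L\<close> at \<open>1 / a\<close>, so the curve is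
  continuous.\<close>

definition price :: "real \<Rightarrow> real" where
  "price x = (if x < 1 / a then L else L * exp (a * x - 1))"

text \<open>Units are numbered from 0: batch \<open>j\<close> consists of the units
  \<open>C j, ..., C (Suc j) - 1\<close>, and it is empty if \<open>q j = 0\<close>.\<close>

definition C :: "nat \<Rightarrow> nat" where "C j = (\<Sum>l\<in>{1..<j}. q l)"

abbreviation idx :: "nat \<Rightarrow> nat" where "idx \<equiv> cPPM_index \<Delta> q"

abbreviation pos :: "nat \<Rightarrow> real \<Rightarrow> real" where "pos \<equiv> z k q"

definition buys :: "real \<Rightarrow> nat \<Rightarrow> real \<Rightarrow> bool" where
  "buys r y v \<longleftrightarrow> y < k \<and> price (pos (idx y) r) \<le> v"

text \<open>Values are a function of time, so that the states of different seeds can be compared at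
  every \<open>t\<close>; an instance \<open>I\<close> enters as \<open>nth I\<close>.\<close>

fun sold :: "(nat \<Rightarrow> real) \<Rightarrow> real \<Rightarrow> nat \<Rightarrow> nat" where
  "sold v r 0 = 0"
| "sold v r (Suc t) = (if buys r (sold v r t) (v t) then Suc (sold v r t) else sold v r t)"

lemma phi_star_eq: "\<phi>_star L U k q j r = price (pos j r)"
  by (simp add: \<phi>_star_def price_def a_def)

lemma a_ge_1: "1 \<le> a"
  using L_pos L_le_U by (simp add: a_def \<alpha>_star_def)

lemma inverse_a: "0 < 1 / a" "1 / a \<le> 1"
  using a_ge_1 by (auto simp: divide_simps)

lemma price_flat: "x \<le> 1 / a \<Longrightarrow> price x = L"
  using a_ge_1 by (auto simp: price_def field_simps)

lemma price_exp: "1 / a \<le> x \<Longrightarrow> price x = L * exp (a * x - 1)"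
  by (simp add: price_def)

lemma price_ge_L: "L \<le> price x"
  using a_ge_1 L_pos by (auto simp: price_def field_simps)

lemma price_mono:
  assumes "x \<le> y"
  shows "price x \<le> price y"
proof (cases "x < 1 / a")
  case True
  then show ?thesis using price_ge_L[of y] by (simp add: price_flat)
next
  case False
  then show ?thesis using assms a_ge_1 L_pos by (simp add: price_exp)
qed

lemma price_pos: "0 < price x"
  using price_ge_L[of x] L_pos by simp

lemma C_1 [simp]: "C (Suc 0) = 0"
  by (simp add: C_def)

lemma C_Suc: "1 \<le> j \<Longrightarrow> C (Suc j) = C j + q j"
  by (simp add: C_def)

lemma C_mono: "i \<le> j \<Longrightarrow> C i \<le> C j"
  unfolding C_def by (rule sum_mono2) auto

lemma C_top: "C (Suc (Suc \<Delta>)) = k"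
  using q_sum by (simp add: C_def atLeastLessThanSuc_atLeastAtMost)

lemma C_le_k: "j \<le> Suc (Suc \<Delta>) \<Longrightarrow> C j \<le> k"
  using C_mono C_top by metis

lemma idx_eq:
  assumes "1 \<le> j" "j \<le> Suc \<Delta>" "C j \<le> y" "y < C (Suc j)"
  shows "idx y = j"
  unfolding cPPM_index_def
proof (rule Max_eqI)
  fix i assume "i \<in> {j \<in> {1..\<Delta> + 1}. sum q {1..<j} \<le> y}"
  then have "C i \<le> y" by (simp add: C_def)
  then show "i \<le> j" using assms(4) C_mono[of "Suc j" i] by fastforce
qed (use assms in \<open>auto simp: C_def\<close>)

text \<open>\<open>Max\<close> picks the last batch that starts at or before unit \<open>y\<close>,
  hence never an empty one; in the last batch the upper bound is \<open>k\<close>.\<close>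

lemma idx_props:
  assumes "y < k"
  shows "1 \<le> idx y" "idx y \<le> Suc \<Delta>" "C (idx y) \<le> y" "y < C (Suc (idx y))"
proof -
  let ?S = "{j \<in> {1..\<Delta> + 1}. sum q {1..<j} \<le> y}"
  have "Suc 0 \<in> ?S" by simp
  then have "Max ?S \<in> ?S" by (intro Max_in) auto
  then have mem: "idx y \<in> ?S" by (simp add: cPPM_index_def)
  then show *: "1 \<le> idx y" "idx y \<le> Suc \<Delta>" "C (idx y) \<le> y" by (auto simp: C_def)
  show "y < C (Suc (idx y))"
  proof (rule ccontr)
    assume "\<not> y < C (Suc (idx y))"
    then have le: "C (Suc (idx y)) \<le> y" by simp
    show False
    proof (cases "idx y = Suc \<Delta>")
      case True
      then show False using le C_top assms by simp
    next
      case False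
      then have "Suc (idx y) \<in> ?S" using le * by (auto simp: C_def)
      then have "Suc (idx y) \<le> idx y" unfolding cPPM_index_def by (intro Max_ge) auto
      then show False by simp
    qed
  qed
qed

lemma idx_mono:
  assumes "x \<le> y" "y < k"
  shows "idx x \<le> idx y"
proof (rule ccontr)
  assume "\<not> idx x \<le> idx y"
  then have "C (Suc (idx y)) \<le> C (idx x)" by (intro C_mono) simp
  then show False using idx_props[of x] idx_props[of y] assms by simp
qed

lemma pos_eq: "pos j r = (real (C j) + real (q j) * r) / real k"
  by (simp add: z_def C_def)

lemma pos_bounds:
  assumes "1 \<le> j" "r \<in> {0..1}"
  shows "real (C j) / real k \<le> pos j r" "pos j r \<le> real (C (Suc j)) / real k"
proof -
  have "real (q j) * r \<le> real (q j)" using assms by (simp add: mult_left_le)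
  then show "real (C j) / real k \<le> pos j r" "pos j r \<le> real (C (Suc j)) / real k"
    using assms by (auto simp: pos_eq C_Suc intro!: divide_right_mono)
qed

lemma pos_less:
  assumes "1 \<le> i" "i < j" "r \<in> {0..1}" "r' \<in> {0..1}"
  shows "pos i r \<le> pos j r'"
proof -
  have "real (C (Suc i)) / real k \<le> real (C j) / real k"
    using assms C_mono[of "Suc i" j] by (intro divide_right_mono) auto
  then show ?thesis using pos_bounds(2)[of i r] pos_bounds(1)[of j r'] assms by simp
qed

lemma pos_mono: "r \<le> r' \<Longrightarrow> pos j r \<le> pos j r'"
  by (auto simp: pos_eq intro!: divide_right_mono mult_left_mono)

lemma pos_mono_idx:
  assumes "1 \<le> i" "i \<le> j" "r \<in> {0..1}"
  shows "pos i r \<le> pos j r"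
  using pos_less[of i j r r] assms by (cases "i = j") auto

section \<open>Comparison of the sales of two seeds\<close>

lemma sold_mono: "s \<le> t \<Longrightarrow> sold v r s \<le> sold v r t"
  by (rule lift_Suc_mono_le[of "sold v r"]) auto

lemma sold_le_k: "sold v r t \<le> k"
  by (induction t) (auto simp: buys_def)

text \<open>At equal counts the larger seed faces a price at least as high, so it cannot overtake; a
  strict lead survives one step because a buyer takes at most one unit.\<close>

lemma sold_antimono:
  assumes "r \<le> r'"
  shows "sold v r' t \<le> sold v r t"
proof (induction t)
  case (Suc t)
  show ?case
  proof (cases "sold v r' t = sold v r t")
    case True
    then show ?thesis
      using price_mono[OF pos_mono[OF assms, of "idx (sold v r t)"]] by (auto simp: buys_def)
  next
    case False
    then show ?thesis using Suc by auto
  qed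
qed simp

lemma C_eq_0:
  assumes "1 \<le> j" "j \<le> Suc \<Delta>" "q j = 0"
  shows "C j = 0"
proof -
  have "q l = 0" if "l \<in> {1..<j}" for l using q_mono[of l j] assms that by auto
  then show ?thesis by (simp add: C_def)
qed

text \<open>The last price of a batch is at most the first price of the next one, so a seed lagging a
  batch behind buys whenever the leading one does; because the batch sizes increase, it completes
  its own batch before the leading seed does.\<close>

lemma sold_lag:
  assumes r: "r \<in> {0..1}" "r' \<in> {0..1}"
  shows "1 \<le> j \<Longrightarrow> j \<le> \<Delta> \<Longrightarrow> 1 \<le> m \<Longrightarrow> m \<le> q j \<Longrightarrow> C (Suc j) + m \<le> sold v r t
    \<Longrightarrow> C j + m \<le> sold v r' t"
proof (induction t arbitrary: j m)
  case (Suc t)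
  let ?y = "sold v r t" and ?y' = "sold v r' t"
  have qj: "q j \<le> q (Suc j)" using q_mono[of j "Suc j"] Suc.prems by simp
  show ?case
  proof (cases "C (Suc j) + m \<le> ?y")
    case True
    have "C j + m \<le> ?y'" using Suc.IH[OF Suc.prems(1-4) True] .
    then show ?thesis by simp
  next
    case False
    with Suc.prems(5) have y: "Suc ?y = C (Suc j) + m" and b: "buys r ?y (v t)"
      by (auto split: if_splits)
    \<comment> \<open>For \<open>m > 1\<close> this is the claim for \<open>m - 1\<close>. For
      \<open>m = 1\<close> it says that \<open>r'\<close> has completed batch \<open>j - 1\<close>:
      the claim for \<open>j - 1\<close> with \<open>m = q (j - 1)\<close>, usable since
      \<open>q (j - 1) \<le> q j\<close>. If no nonempty batch precedes,
      \<open>C j = 0\<close>.\<close>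
    have lag: "C j + (m - 1) \<le> ?y'"
    proof (cases "m = 1")
      case False
      then show ?thesis using Suc.IH[of j "m - 1"] Suc.prems y by simp
    next
      case True
      show ?thesis
      proof (cases "j = 1 \<or> q (j - 1) = 0")
        case True
        then have "C j = 0"
        proof
          assume "q (j - 1) = 0"
          then show "C j = 0"
            using C_eq_0[of "j - 1"] C_Suc[of "j - 1"] Suc.prems by (cases "j = 1") auto
        qed simp
        then show ?thesis using \<open>m = 1\<close> by simp
      next
        case False
        have "q (j - 1) \<le> q j" using q_mono[of "j - 1" j] Suc.prems False by force
        then have "C j + q (j - 1) \<le> ?y" using y \<open>m = 1\<close> C_Suc[of j] Suc.prems by simp
        moreover have "1 \<le> j - 1" "1 \<le> q (j - 1)" using False Suc.prems by linarith+
        ultimately have "C (j - 1) + q (j - 1) \<le> ?y'"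
          using Suc.IH[of "j - 1" "q (j - 1)"] C_Suc[of "j - 1"] Suc.prems by simp
        then show ?thesis using C_Suc[OF \<open>1 \<le> j - 1\<close>] Suc.prems \<open>m = 1\<close> by simp
      qed
    qed
    have "?y < C (Suc (Suc j))" using y Suc.prems qj C_Suc[of "Suc j"] by simp
    then have idx_y: "idx ?y = Suc j" using y Suc.prems by (intro idx_eq) auto
    show ?thesis
    proof (cases "buys r' ?y' (v t)")
      case True
      then show ?thesis using lag Suc.prems by simp
    next
      case False
      \<comment> \<open>A refusal means that \<open>r'\<close> is already past batch
        \<open>j\<close>: its prices up to batch \<open>j\<close> are at most the price that
        \<open>r\<close> accepts in batch \<open>Suc j\<close>.\<close>
      have "C (Suc j) \<le> ?y'"
      proof (rule ccontr)
        assume "\<not> C (Suc j) \<le> ?y'"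
        then have less: "?y' < C (Suc j)" by simp
        then have "?y' < k" using C_le_k[of "Suc j"] Suc.prems by simp
        note i = idx_props[OF this]
        have "idx ?y' < Suc j"
        proof (rule ccontr)
          assume "\<not> idx ?y' < Suc j"
          then have "C (Suc j) \<le> C (idx ?y')" by (intro C_mono) simp
          then show False using i less by simp
        qed
        then have "price (pos (idx ?y') r') \<le> price (pos (idx ?y) r)"
          using i r idx_y by (intro price_mono pos_less) auto
        then show False using False b \<open>?y' < k\<close> by (auto simp: buys_def)
      qed
      then show ?thesis using C_Suc[of j] Suc.prems False by simp
    qed
  qed
qed simp

text \<open>A seed that has completed batch \<open>j\<close> has sold at least
  \<open>q (j - 1)\<close> units of it, so \<open>sold_lag\<close> with \<open>m = q (j - 1)\<close>
  makes every other seed complete batch \<open>j - 1\<close>.\<close>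

lemma sold_interleave:
  assumes r: "r \<in> {0..1}" "r' \<in> {0..1}"
    and j: "1 \<le> j" "j \<le> Suc \<Delta>" "C (Suc j) \<le> sold v r t"
  shows "C j \<le> sold v r' t"
proof (cases "j = 1 \<or> q (j - 1) = 0")
  case True
  then have "C j = 0"
  proof
    assume "q (j - 1) = 0"
    then show "C j = 0"
      using C_eq_0[of "j - 1"] C_Suc[of "j - 1"] j by (cases "j = 1") auto
  qed simp
  then show ?thesis by simp
next
  case False
  have "q (j - 1) \<le> q j" using q_mono[of "j - 1" j] j False by force
  then have "C j + q (j - 1) \<le> sold v r t" using C_Suc[of j] j by simp
  moreover have "1 \<le> j - 1" "1 \<le> q (j - 1)" using False j by linarith+
  ultimately have "C (j - 1) + q (j - 1) \<le> sold v r' t"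
    using sold_lag[OF r, of "j - 1" "q (j - 1)"] C_Suc[of "j - 1"] j by simp
  then show ?thesis using C_Suc[OF \<open>1 \<le> j - 1\<close>] j by simp
qed

section \<open>Sums and integrals over units\<close>

lemma sum_idx:
  fixes h :: "nat \<Rightarrow> real"
  shows "(\<Sum>y<k. h (idx y)) = (\<Sum>j\<in>{1..Suc \<Delta>}. real (q j) * h j)"
proof -
  have "J \<le> Suc \<Delta> \<Longrightarrow> (\<Sum>y<C (Suc J). h (idx y)) = (\<Sum>j\<in>{1..J}. real (q j) * h j)" for J
  proof (induction J)
    case (Suc J)
    have "{..<C (Suc (Suc J))} = {..<C (Suc J)} \<union> {C (Suc J)..<C (Suc (Suc J))}"
      using C_mono[of "Suc J" "Suc (Suc J)"] by auto
    then have "(\<Sum>y<C (Suc (Suc J)). h (idx y))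
        = (\<Sum>y<C (Suc J). h (idx y)) + (\<Sum>y\<in>{C (Suc J)..<C (Suc (Suc J))}. h (idx y))"
      by (simp add: sum.union_disjoint ivl_disj_int)
    also have "(\<Sum>y\<in>{C (Suc J)..<C (Suc (Suc J))}. h (idx y))
        = (\<Sum>y\<in>{C (Suc J)..<C (Suc (Suc J))}. h (Suc J))"
      using Suc.prems by (intro sum.cong refl arg_cong[of _ _ h] idx_eq) auto
    also have "\<dots> = real (q (Suc J)) * h (Suc J)" by (simp add: C_Suc)
    finally show ?case using Suc by simp
  qed simp
  from this[of "Suc \<Delta>"] show ?thesis by (simp add: C_top)
qed

text \<open>Each purchase takes the next unit, so the purchases before time \<open>n\<close> use
  every unit below \<open>sold v r n\<close> exactly once.\<close>

lemma sum_sold: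
  fixes h :: "nat \<Rightarrow> real"
  shows "(\<Sum>t<n. if buys r (sold v r t) (v t) then h (sold v r t) else 0) = (\<Sum>y<sold v r n. h y)"
  by (induction n) auto

lemma cPPM_from_eq:
  "cPPM_from k \<Delta> (\<phi>_star L U k q) q r (sold (nth I) r t) (drop t I)
    = (\<Sum>s\<in>{t..<length I}. if buys r (sold (nth I) r s) (I ! s) then I ! s else 0)"
proof (induction "length I - t" arbitrary: t)
  case (Suc n)
  then have t: "t < length I" by simp
  have "{t..<length I} = insert t {Suc t..<length I}" using t by auto
  have drop: "drop t I = I ! t # drop (Suc t) I" using Cons_nth_drop_Suc[OF t] by simp
  have IH: "cPPM_from k \<Delta> (\<phi>_star L U k q) q r (sold (nth I) r (Suc t)) (drop (Suc t) I)
      = (\<Sum>s\<in>{Suc t..<length I}. if buys r (sold (nth I) r s) (I ! s) then I ! s else 0)"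
    using Suc.hyps(2) by (intro Suc.hyps(1)) simp
  show ?case
    using IH unfolding drop \<open>{t..<length I} = insert t {Suc t..<length I}\<close>
    by (auto simp: buys_def phi_star_eq)
qed simp

lemma cPPM_eq:
  "cPPM k \<Delta> (\<phi>_star L U k q) q I r
    = (\<Sum>t<length I. if buys r (sold (nth I) r t) (I ! t) then I ! t else 0)"
  using cPPM_from_eq[of r I 0] by (simp add: cPPM_def atLeast0LessThan)

text \<open>Along increasing positions, the marginal units of all seeds form an interval, so a position
  between two marginal positions is itself the marginal position of its own seed.\<close>

lemma sold_in_batch:
  assumes r: "r \<in> {0..1}" and j: "1 \<le> j" "j \<le> Suc \<Delta>"
    and r1: "r1 \<in> {0..1}" "sold v r1 t < k \<Longrightarrow> pos j r < pos (idx (sold v r1 t)) r1"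
    and r2: "r2 \<in> {0..1}" "sold v r2 t < k" "pos (idx (sold v r2 t)) r2 < pos j r"
  shows "C j \<le> sold v r t" "sold v r t < C (Suc j)"
proof -
  let ?y = "sold v r t" and ?y1 = "sold v r1 t" and ?y2 = "sold v r2 t"
  show "C j \<le> ?y"
  proof (cases "C (Suc j) \<le> ?y1")
    case True
    then show ?thesis using sold_interleave[OF r1(1) r j True] by simp
  next
    case False
    \<comment> \<open>Seed \<open>r1\<close> has not completed batch \<open>j\<close>, and its place
      beyond \<open>pos j r\<close> excludes earlier batches. So it is in batch \<open>j\<close> and
      \<open>r \<le> r1\<close>, whence \<open>r\<close> has sold at least as much.\<close>
    then have "?y1 < k" using C_le_k[of "Suc j"] j by simp
    note i = idx_props[OF this] and less = r1(2)[OF this]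
    have "\<not> idx ?y1 < j" using pos_less[OF i(1) _ r1(1) r] less by fastforce
    moreover have "\<not> j < idx ?y1" using C_mono[of "Suc j" "idx ?y1"] i False by fastforce
    ultimately have eq: "idx ?y1 = j" by simp
    then have "r \<le> r1" using less pos_mono[of r1 r j] by fastforce
    then have "?y1 \<le> ?y" by (rule sold_antimono)
    then show ?thesis using eq i by simp
  qed
  show "?y < C (Suc j)"
  proof (rule ccontr)
    assume "\<not> ?y < C (Suc j)"
    then have le: "C (Suc j) \<le> ?y" by simp
    have y2: "C j \<le> ?y2" using sold_interleave[OF r r2(1) j le] .
    \<comment> \<open>Symmetrically, \<open>r2\<close> is in batch \<open>j\<close> and
      \<open>r2 \<le> r\<close>, so \<open>r\<close> has sold no more than \<open>r2\<close> and
      cannot have completed the batch.\<close>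
    note i = idx_props[OF r2(2)]
    have "\<not> j < idx ?y2" using pos_less[OF j(1) _ r r2(1)] r2(3) by fastforce
    moreover have "\<not> idx ?y2 < j" using C_mono[of "Suc (idx ?y2)" j] i y2 by fastforce
    ultimately have eq: "idx ?y2 = j" by simp
    then have "r2 \<le> r" using r2(3) pos_mono[of r r2 j] by fastforce
    then have "?y \<le> ?y2" by (rule sold_antimono)
    then show False using eq i le by simp
  qed
qed

text \<open>The map \<open>pos j\<close> sends [0, 1] affinely, with slope \<open>q j / k\<close>,
  onto the interval from \<open>C j / k\<close> to \<open>C (Suc j) / k\<close>, and these intervals
  tile [0, 1].\<close>

lemma has_integral_batches:
  assumes g: "(g has_integral i) {0..1}"
  shows "((\<lambda>r. \<Sum>j\<in>{1..Suc \<Delta>}. real (q j) * g (pos j r)) has_integral real k * i) {0..1}"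
proof -
  have k: "real k > 0" using k_pos by simp
  have int: "g integrable_on {x..y}" if "0 \<le> x" "y \<le> 1" for x y
    using integrable_on_subinterval[of g "{0..1}" x y] g that by (auto simp: integrable_on_def)
  have C_le: "real (C j) / real k \<le> 1" if "j \<le> Suc (Suc \<Delta>)" for j
    using C_le_k[OF that] k by simp
  have one: "((\<lambda>r. real (q j) * g (pos j r)) has_integral
      real k * integral {real (C j) / real k..real (C (Suc j)) / real k} g) {0..1}"
    if j: "1 \<le> j" "j \<le> Suc \<Delta>" for j
  proof (cases "q j = 0")
    case True
    then show ?thesis using j by (simp add: C_Suc)
  next
    case False
    let ?m = "real (q j) / real k" and ?c = "real (C j) / real k"
    have m: "?m > 0" using False k by simp
    have "(g has_integral integral {?c..real (C (Suc j)) / real k} g)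
        (cbox ?c (real (C (Suc j)) / real k))"
      using int[of ?c "real (C (Suc j)) / real k"] C_le[of "Suc j"] j
      by (simp add: has_integral_integral)
    from has_integral_affinity'[OF this m, of ?c]
    have "((\<lambda>r. g (?m * r + ?c)) has_integral
        integral {?c..real (C (Suc j)) / real k} g / ?m) {0..1}"
      using m False k j by (simp add: C_Suc field_simps)
    then have "((\<lambda>r. real (q j) * g (?m * r + ?c)) has_integral
        real (q j) * (integral {?c..real (C (Suc j)) / real k} g / ?m)) {0..1}"
      by (rule has_integral_mult_right)
    moreover have "?m * r + ?c = pos j r" for r
      using k by (simp add: pos_eq field_simps)
    ultimately show ?thesis using False k by (simp add: field_simps)
  qed
  have "J \<le> Suc \<Delta> \<Longrightarrow> ((\<lambda>r. \<Sum>j\<in>{1..J}. real (q j) * g (pos j r)) has_integral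
      real k * integral {0..real (C (Suc J)) / real k} g) {0..1}" for J
  proof (induction J)
    case (Suc J)
    have "integral {0..real (C (Suc J)) / real k} g
        + integral {real (C (Suc J)) / real k..real (C (Suc (Suc J))) / real k} g
        = integral {0..real (C (Suc (Suc J))) / real k} g"
      using C_mono[of "Suc J" "Suc (Suc J)"] C_le[of "Suc (Suc J)"] Suc.prems k
      by (intro Henstock_Kurzweil_Integration.integral_combine int) (auto intro!: divide_right_mono)
    then show ?case
      using has_integral_add[OF Suc.IH one[of "Suc J"]] Suc.prems
      by (simp add: distrib_left[symmetric])
  qed simp
  from this[of "Suc \<Delta>"] show ?thesis
    using C_top k g by (simp add: integral_unique)
qed

text \<open>On the steep part the curve satisfies \<open>price' = a * price\<close>, and the flat
  part of length \<open>1 / a\<close> supplies exactly the initial value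
  \<open>L / a\<close>.\<close>

lemma has_integral_price:
  assumes "1 / a \<le> Z"
  shows "(price has_integral price Z / a) {0..Z}"
proof -
  have a: "a > 0" using a_ge_1 by simp
  have "((\<lambda>x. L) has_integral L / a) {0..1 / a}"
    using has_integral_const_real[of L 0 "1 / a"] inverse_a by simp
  then have 1: "(price has_integral L / a) {0..1 / a}"
    by (rule has_integral_eq[rotated]) (simp add: price_flat)
  have "((\<lambda>x. L * exp (a * x - 1)) has_integral
      L * exp (a * Z - 1) / a - L * exp (a * (1 / a) - 1) / a) {1 / a..Z}"
    using assms a by (intro fundamental_theorem_of_calculus)
      (auto intro!: derivative_eq_intros simp: has_real_derivative_iff_has_vector_derivative[symmetric])
  then have "((\<lambda>x. L * exp (a * x - 1)) has_integral price Z / a - L / a) {1 / a..Z}"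
    using a assms by (simp add: price_exp)
  then have 2: "(price has_integral price Z / a - L / a) {1 / a..Z}"
    by (rule has_integral_eq[rotated]) (simp add: price_exp)
  show ?thesis using has_integral_combine[OF _ assms 1 2] inverse_a by simp
qed

text \<open>The inverse of the steep part of the curve: the position at which the price is
  \<open>v\<close>.\<close>

definition level :: "real \<Rightarrow> real" where "level v = (1 + ln (v / L)) / a"

text \<open>By the choice of \<open>a\<close> the curve reaches \<open>U\<close> exactly at position
  1.\<close>

lemma level:
  assumes "v \<in> {L..U}"
  shows "1 / a \<le> level v" "level v \<le> 1" "price (level v) = v"
proof -
  have a: "a > 0" using a_ge_1 by simp
  have v: "v > 0" "1 \<le> v / L" "v / L \<le> U / L" using assms L_pos by (auto simp: divide_simps)
  have ln: "0 \<le> ln (v / L)" "ln (v / L) \<le> ln (U / L)" using v by auto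
  show 1: "1 / a \<le> level v" unfolding level_def using a ln by (intro divide_right_mono) auto
  show "level v \<le> 1" using a ln by (simp add: level_def a_def \<alpha>_star_def)
  have "a * level v - 1 = ln (v / L)" using a by (simp add: level_def)
  then show "price (level v) = v" using 1 v L_pos by (simp add: price_exp exp_ln)
qed

text \<open>This is \<open>ln x \<le> x - 1\<close> at \<open>x = price Z / v\<close>. It converts a
  length on the curve into the excess of a value over \<open>price Z\<close>.\<close>

lemma level_gap:
  assumes v: "v \<in> {L..U}" and Z: "1 / a \<le> Z"
  shows "v - price Z \<le> a * v * (level v - Z)"
proof -
  have a: "a > 0" using a_ge_1 by simp
  have v0: "v > 0" using v L_pos by simp
  have "a * (level v - Z) = 1 + ln (v / L) - a * Z" using a by (simp add: level_def field_simps)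
  also have "\<dots> = - ln (price Z / v)"
    using L_pos v0 Z by (simp add: price_exp ln_div ln_mult)
  also have "\<dots> \<ge> - (price Z / v - 1)"
    using ln_le_minus_one[of "price Z / v"] price_pos[of Z] v0 by simp
  finally have "v * (1 - price Z / v) \<le> v * (a * (level v - Z))"
    using v0 by (intro mult_left_mono) auto
  then show ?thesis using v0 by (simp add: algebra_simps)
qed

end

section \<open>Bounds on the optimum\<close>

lemma sum_list_take_sort_le:
  fixes f :: "real \<Rightarrow> real"
  assumes "\<And>x. x \<in> set I \<Longrightarrow> 0 \<le> f x"
  shows "sum_list (map f (take k (rev (sort I)))) \<le> (\<Sum>t<length I. f (I ! t))"
proof -
  let ?xs = "rev (sort I)"
  have "sum_list (map f (take k ?xs)) \<le> sum_list (map f (take k ?xs)) + sum_list (map f (drop k ?xs))"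
    using assms by (auto intro!: sum_list_nonneg dest!: in_set_dropD)
  also have "\<dots> = sum_list (map f ?xs)"
    by (metis append_take_drop_id map_append sum_list_append)
  also have "\<dots> = sum_list (map f I)"
    by (metis mset_map mset_rev mset_sort sum_mset_sum_list)
  also have "\<dots> = (\<Sum>t<length I. f (I ! t))"
    by (simp add: sum_list_sum_nth atLeast0LessThan)
  finally show ?thesis .
qed

lemma OPT_le_sum:
  assumes "\<And>x. x \<in> set I \<Longrightarrow> 0 \<le> x"
  shows "OPT k I \<le> (\<Sum>t<length I. I ! t)"
  using sum_list_take_sort_le[of I "\<lambda>x. x" k] assms by (simp add: OPT_def)

text \<open>Each of the at most \<open>k\<close> chosen values \<open>x\<close> is at most
  \<open>c + max 0 (x - c)\<close>, and the nonnegative excesses may be summed over all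
  buyers.\<close>

lemma OPT_le_threshold:
  assumes "0 \<le> c"
  shows "OPT k I \<le> real k * c + (\<Sum>t<length I. max 0 (I ! t - c))"
proof -
  let ?xs = "take k (rev (sort I))"
  have "OPT k I = sum_list (map (\<lambda>x. x) ?xs)" by (simp add: OPT_def)
  also have "\<dots> \<le> sum_list (map (\<lambda>x. c + max 0 (x - c)) ?xs)"
    by (intro sum_list_mono) simp
  also have "\<dots> = real (length ?xs) * c + sum_list (map (\<lambda>x. max 0 (x - c)) ?xs)"
    by (simp add: sum_list_addf sum_list_triv)
  also have "real (length ?xs) * c \<le> real k * c"
    using assms by (intro mult_right_mono) auto
  finally show ?thesis using sum_list_take_sort_le[of I "\<lambda>x. max 0 (x - c)" k] by simp
qed

lemma OPT_pos:
  assumes "I \<noteq> []" "1 \<le> k" "\<And>x. x \<in> set I \<Longrightarrow> 0 < x"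
  shows "0 < OPT k I"
proof -
  have "length (take k (rev (sort I))) \<noteq> 0" using assms(1,2) by simp
  then have "take k (rev (sort I)) \<noteq> []" by (metis list.size(3))
  then obtain x xs where xs: "take k (rev (sort I)) = x # xs" by (meson neq_Nil_conv)
  have "set (x # xs) \<subseteq> set I" unfolding xs[symmetric] using set_take_subset[of k "rev (sort I)"] by simp
  then have "0 < x" "0 \<le> sum_list xs" using assms(3) by (auto intro!: sum_list_nonneg dest: less_imp_le)
  then show ?thesis by (simp add: OPT_def xs)
qed

section \<open>Expectation and CVaR under the uniform seed\<close>

interpretation seed: prob_space seed
  unfolding seed_def by (rule prob_space_uniform_measure) auto

lemma integrable_seed:
  fixes X :: "real \<Rightarrow> real"
  assumes [measurable]: "X \<in> borel_measurable borel" and "\<And>r. \<bar>X r\<bar> \<le> B"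
  shows "integrable seed X"
  by (rule seed.integrable_const_bound[of _ B]) (use assms in \<open>auto simp: seed_def\<close>)

text \<open>Links the expectation to the gauge integral, in which the substitution along the batches
  is carried out.\<close>

lemma has_integral_seed:
  fixes X :: "real \<Rightarrow> real"
  assumes [measurable]: "X \<in> borel_measurable borel" and "\<And>r. \<bar>X r\<bar> \<le> B"
  shows "(X has_integral (\<integral>r. X r \<partial>seed)) {0..1}"
proof -
  have seed: "seed = density lborel (\<lambda>x. ennreal (indicator {0..1} x))"
    by (simp add: seed_def uniform_measure_def ennreal_indicator divide_ennreal_def)
  have "(\<integral>r. X r \<partial>seed) = (\<integral>r\<in>{0..1}. X r \<partial>lborel)"
    unfolding set_lebesgue_integral_def seed by (rule integral_density) auto
  moreover have "set_integrable lborel {0..1} X"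
    using integrable_seed[OF assms] unfolding set_integrable_def seed
    by (subst (asm) integrable_density) auto
  ultimately show ?thesis
    using set_borel_integral_eq_integral[of "{0..1}" X] by (simp add: has_integral_integral)
qed

text \<open>At \<open>\<tau> = B\<close> the difference \<open>\<tau> - X\<close> is nonnegative, so
  the positive part disappears and the term of the supremum equals the expectation.\<close>

lemma CVaR_1_ge_expectation:
  assumes "X \<in> borel_measurable borel" "\<And>r. \<bar>X r\<bar> \<le> B"
  shows "ereal (\<integral>r. X r \<partial>seed) \<le> CVaR 1 seed X"
proof -
  have "(\<integral>r. max 0 (B - X r) \<partial>seed) = (\<integral>r. B - X r \<partial>seed)"
    using assms(2) by (intro Bochner_Integration.integral_cong) (auto simp: abs_le_iff max_def)
  also have "\<dots> = B - (\<integral>r. X r \<partial>seed)"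
    using integrable_seed[OF assms] by (simp add: seed.prob_space)
  finally have "(\<integral>r. X r \<partial>seed) = B - 1 / 1 * (\<integral>r. max 0 (B - X r) \<partial>seed)" by simp
  then show ?thesis unfolding CVaR_def by (metis (mono_tags, lifting) SUP_upper UNIV_I)
qed

section \<open>Welfare contributed by each buyer\<close>

context price_curve
begin

text \<open>The position of the next unit of seed \<open>r\<close>. It has this meaning only while
  \<open>sold v r t < k\<close>, since at \<open>k\<close> the index stays at the last
  batch.\<close>

abbreviation place :: "(nat \<Rightarrow> real) \<Rightarrow> real \<Rightarrow> nat \<Rightarrow> real" where
  "place v r t \<equiv> pos (idx (sold v r t)) r"

lemma place_mono:
  assumes "r \<in> {0..1}" "s \<le> t" "sold v r t < k"
  shows "place v r s \<le> place v r t"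
proof -
  have le: "sold v r s \<le> sold v r t" using sold_mono[OF assms(2)] .
  then show ?thesis
    using idx_mono[OF le assms(3)] idx_props(1)[of "sold v r s"] assms
    by (intro pos_mono_idx) auto
qed

text \<open>The part of a sale credited to the unit at position \<open>x\<close>;
  \<open>gain\<close> is the part credited to the buyer.\<close>

definition base :: "real \<Rightarrow> real \<Rightarrow> real" where
  "base Z x = (if x < Z then price x else 0)"

text \<open>A lower bound on the value that buyer \<open>t\<close> adds to seed \<open>r\<close> beyond \<open>base\<close>. The weights
  \<open>q j / k\<close>, at most \<open>1\<close> in total, turn the average over the seeds into the length of the
  interval.\<close>

definition gain :: "(nat \<Rightarrow> real) \<Rightarrow> real \<Rightarrow> nat \<Rightarrow> real \<Rightarrow> real" where
  "gain v Z t r =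
    (if \<forall>s\<in>{0..1}. buys s (sold v s t) (v t) then max 0 (v t - price Z)
     else v t / real k * (\<Sum>j\<in>{1..Suc \<Delta>}. real (q j) * indicator {Z<..<level (v t)} (pos j r)))"

lemma base_nonneg: "0 \<le> base Z x"
  using price_pos[of x] by (simp add: base_def)

text \<open>If all seeds buy, \<open>base\<close> is at most both \<open>price Z\<close> and
  \<open>v t\<close>. If some seed refuses, a nonzero \<open>gain\<close> puts
  \<open>pos j r\<close> between the place of a seed near \<open>Z\<close> and that of a refusing
  seed, so it is the next unit of \<open>r\<close> and \<open>r\<close> buys it. The hypothesis
  \<open>reach\<close> covers an infimum \<open>Z\<close> that no seed attains.\<close>

lemma base_gain_le:
  assumes r: "r \<in> {0..1}" and v: "v t \<in> {L..U}" and t: "t < n"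
    and reach: "\<And>x. Z < x \<Longrightarrow> x \<le> 1 \<Longrightarrow> \<exists>s\<in>{0..1}. sold v s n < k \<and> place v s n < x"
  shows "(if buys r (sold v r t) (v t) then base Z (place v r t) else 0) + gain v Z t r
    \<le> (if buys r (sold v r t) (v t) then v t else 0)"
proof (cases "\<forall>s\<in>{0..1}. buys s (sold v s t) (v t)")
  case True
  then have b: "buys r (sold v r t) (v t)" using r by blast
  have "base Z (place v r t) + max 0 (v t - price Z) \<le> v t"
  proof (cases "place v r t < Z")
    case True
    then show ?thesis using price_mono[of "place v r t" Z] b
      by (simp add: base_def buys_def max_def)
  next
    case False
    then show ?thesis using price_pos[of Z] v L_pos by (simp add: base_def)
  qed
  then show ?thesis using True b by (simp add: gain_def)
next
  case False
  then obtain r1 where r1: "r1 \<in> {0..1}" "\<not> buys r1 (sold v r1 t) (v t)" by blast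
  have v0: "v t > 0" using v L_pos by simp
  note lv = level[OF v]
  let ?S = "\<Sum>j\<in>{1..Suc \<Delta>}. real (q j) * (indicator {Z<..<level (v t)} (pos j r) :: real)"
  have gain: "gain v Z t r = v t / real k * ?S" unfolding gain_def using False by (simp only: if_False)
  show ?thesis
  proof (cases "\<exists>j\<in>{1..Suc \<Delta>}. pos j r \<in> {Z<..<level (v t)}")
    case True
    then obtain j where j: "1 \<le> j" "j \<le> Suc \<Delta>" "Z < pos j r" "pos j r < level (v t)" by auto
    obtain r2 where r2: "r2 \<in> {0..1}" "sold v r2 n < k" "place v r2 n < pos j r"
      using reach[of "pos j r"] j lv by auto
    have sold2: "sold v r2 t < k" using sold_mono[of t n v r2] t r2 by simp
    \<comment> \<open>Places only move up in time, so a seed below \<open>pos j r\<close> at the end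
      was below it at time \<open>t\<close>.\<close>
    have place2: "place v r2 t < pos j r" using place_mono[of r2 t n v] t r2 by simp
    have place1: "pos j r < place v r1 t" if "sold v r1 t < k"
    proof (rule ccontr)
      assume "\<not> pos j r < place v r1 t"
      then have "price (place v r1 t) \<le> price (level (v t))" using j by (intro price_mono) simp
      then show False using r1(2) that lv by (simp add: buys_def)
    qed
    note batch = sold_in_batch[OF r j(1,2) r1(1) place1 r2(1) sold2 place2]
    have idx: "idx (sold v r t) = j" using idx_eq[OF j(1,2) batch] .
    have lt: "sold v r t < k" using batch(2) C_le_k[of "Suc j"] j by simp
    have "price (pos j r) \<le> v t" using price_mono[of "pos j r" "level (v t)"] j lv by simp
    then have b: "buys r (sold v r t) (v t)" using idx lt by (simp add: buys_def)
    \<comment> \<open>Since \<open>Z < pos j r\<close>, \<open>base\<close> vanishes at this sale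
      and the whole of \<open>v t\<close> is available for \<open>gain\<close>.\<close>
    have "?S \<le> (\<Sum>j\<in>{1..Suc \<Delta>}. real (q j) * 1)"
      by (intro sum_mono mult_left_mono) (auto simp: indicator_def)
    also have "\<dots> = real k" using q_sum by (simp flip: of_nat_sum)
    finally have "v t / real k * ?S \<le> v t / real k * real k" using v0 by (intro mult_left_mono) auto
    then show ?thesis using b gain idx j k_pos by (simp add: base_def)
  next
    case False
    then have "?S = 0" by (intro sum.neutral) (auto simp: indicator_def)
    then have "gain v Z t r = 0" using gain by simp
    moreover have "base Z (place v r t) \<le> v t" if "buys r (sold v r t) (v t)"
      using that v0 by (simp add: base_def buys_def)
    ultimately show ?thesis by simp
  qed
qed

lemma has_integral_indicator_Ioo:
  assumes "0 \<le> c" "d \<le> 1"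
  shows "((indicator {c<..<d} :: real \<Rightarrow> real) has_integral max 0 (d - c)) {0..1}"
proof (cases "c \<le> d")
  case True
  have "((\<lambda>x. 1 :: real) has_integral (d - c)) {c<..<d}"
    using has_integral_const_real[of "1::real" c d] True by (simp add: has_integral_Icc_iff_Ioo)
  then have "((\<lambda>x. if x \<in> {c<..<d} then 1 else 0 :: real) has_integral (d - c)) {0..1}"
    using assms by (subst has_integral_restrict) auto
  moreover have "indicator {c<..<d} = (\<lambda>x. if x \<in> {c<..<d} then 1 else 0 :: real)"
    by (auto simp: indicator_def)
  ultimately show ?thesis using True by simp
qed (simp add: indicator_def[abs_def])

text \<open>If some seed refuses, \<open>has_integral_batches\<close> turns \<open>gain\<close> into
  \<open>v t\<close> times the length of the interval from \<open>Z\<close> to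
  \<open>level (v t)\<close>, and \<open>level_gap\<close> applies. If all seeds buy, the bound
  follows from \<open>a \<ge> 1\<close>.\<close>

lemma gain_integral:
  assumes v: "v t \<in> {L..U}" and Z: "1 / a \<le> Z"
  obtains D where "(gain v Z t has_integral D) {0..1}" "max 0 (v t - price Z) / a \<le> D"
proof (cases "\<forall>s\<in>{0..1}. buys s (sold v s t) (v t)")
  case True
  have "gain v Z t = (\<lambda>_. max 0 (v t - price Z))" unfolding gain_def fun_eq_iff using True by simp
  then have "(gain v Z t has_integral max 0 (v t - price Z)) {0..1}"
    using has_integral_const_real[of "max 0 (v t - price Z)" 0 1] by simp
  moreover have "max 0 (v t - price Z) / a \<le> max 0 (v t - price Z) / 1"
    using a_ge_1 by (intro divide_left_mono) auto
  ultimately show ?thesis using that by simp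
next
  case False
  have v0: "v t > 0" using v L_pos by simp
  have a: "a > 0" using a_ge_1 by simp
  let ?m = "max 0 (level (v t) - Z)"
  have "gain v Z t = (\<lambda>r. v t / real k *
      (\<Sum>j\<in>{1..Suc \<Delta>}. real (q j) * indicator {Z<..<level (v t)} (pos j r)))"
    unfolding gain_def fun_eq_iff using False by (simp only: if_False) simp
  moreover have "((indicator {Z<..<level (v t)} :: real \<Rightarrow> real) has_integral ?m) {0..1}"
    using Z inverse_a level[OF v] by (intro has_integral_indicator_Ioo) linarith+
  ultimately have "(gain v Z t has_integral v t / real k * (real k * ?m)) {0..1}"
    by (simp only:) (intro has_integral_mult_right has_integral_batches)
  then have "(gain v Z t has_integral v t * ?m) {0..1}" using k_pos by simp
  moreover have "v t - price Z \<le> a * (v t * ?m)"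
  proof -
    have "v t - price Z \<le> a * v t * (level (v t) - Z)" by (rule level_gap[OF v Z])
    also have "\<dots> \<le> a * v t * ?m" using a v0 by (intro mult_left_mono) auto
    finally show ?thesis by (simp add: mult.assoc)
  qed
  then have "max 0 (v t - price Z) / a \<le> v t * ?m"
    using a v0 by (simp add: pos_divide_le_eq mult.commute)
  ultimately show ?thesis using that by blast
qed

lemma has_integral_base:
  assumes "1 / a \<le> Z" "Z \<le> 1"
  shows "(base Z has_integral price Z / a) {0..1}"
proof -
  have "((\<lambda>x. if x \<in> {0..Z} then price x else 0) has_integral price Z / a) {0..1}"
    using assms by (subst has_integral_restrict) (auto intro: has_integral_price)
  then show ?thesis
    by (rule has_integral_spike_finite[of "{Z}", rotated 2]) (auto simp: base_def)
qed

section \<open>Expected welfare of the mechanism\<close>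

lemma cPPM_measurable: "cPPM k \<Delta> (\<phi>_star L U k q) q I \<in> borel_measurable borel"
proof -
  have [measurable]: "\<phi>_star L U k q j \<in> borel_measurable borel" for j
    unfolding \<phi>_star_def z_def by measurable
  have "(\<lambda>r. cPPM_from k \<Delta> (\<phi>_star L U k q) q r y I) \<in> borel_measurable borel" for y
  proof (induction I arbitrary: y)
    case (Cons v vs)
    note [measurable] = Cons[of y] Cons[of "Suc y"]
    show ?case by simp
  qed simp
  then show ?thesis unfolding cPPM_def by simp
qed

lemma cPPM_bounds:
  assumes "set I \<subseteq> {L..U}"
  shows "\<bar>cPPM k \<Delta> (\<phi>_star L U k q) q I r\<bar> \<le> (\<Sum>t<length I. I ! t)"
proof -
  have nn: "0 \<le> I ! t" if "t < length I" for t
    using nth_mem[OF that] assms L_pos by fastforce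
  have "cPPM k \<Delta> (\<phi>_star L U k q) q I r \<le> (\<Sum>t<length I. I ! t)"
    unfolding cPPM_eq using nn by (intro sum_mono) auto
  moreover have "0 \<le> cPPM k \<Delta> (\<phi>_star L U k q) q I r"
    unfolding cPPM_eq using nn by (intro sum_nonneg) auto
  ultimately show ?thesis by simp
qed

text \<open>Common core of the flat and the steep case, obtained by summing
  \<open>base_gain_le\<close> over the buyers and integrating. \<open>F\<close> stands for whichever
  lower bound on the \<open>base\<close> part has a known integral.\<close>

lemma expectation_ge:
  assumes I: "set I \<subseteq> {L..U}" and Z: "1 / a \<le> Z"
    and reach: "\<And>x. Z < x \<Longrightarrow> x \<le> 1 \<Longrightarrow>
      \<exists>s\<in>{0..1}. sold (nth I) s (length I) < k \<and> place (nth I) s (length I) < x"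
    and F: "(F has_integral A) {0..1}"
    and F_le: "\<And>r. r \<in> {0..1} \<Longrightarrow> F r \<le> (\<Sum>y<sold (nth I) r (length I). base Z (pos (idx y) r))"
  shows "A + (\<Sum>t<length I. max 0 (I ! t - price Z)) / a
    \<le> (\<integral>r. cPPM k \<Delta> (\<phi>_star L U k q) q I r \<partial>seed)"
proof -
  let ?n = "length I" and ?v = "nth I"
  have v: "I ! t \<in> {L..U}" if "t < ?n" for t using nth_mem[OF that] I by blast
  have "\<exists>D. (gain ?v Z t has_integral D) {0..1} \<and> max 0 (I ! t - price Z) / a \<le> D" if "t < ?n" for t
    using gain_integral[where v = ?v and t = t, OF v[OF that] Z] by metis
  then obtain D where D: "\<And>t. t < ?n \<Longrightarrow> (gain ?v Z t has_integral D t) {0..1}"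
      "\<And>t. t < ?n \<Longrightarrow> max 0 (I ! t - price Z) / a \<le> D t"
    by metis
  have le: "F r + (\<Sum>t<?n. gain ?v Z t r) \<le> cPPM k \<Delta> (\<phi>_star L U k q) q I r" if r: "r \<in> {0..1}" for r
  proof -
    have "F r + (\<Sum>t<?n. gain ?v Z t r)
        \<le> (\<Sum>t<?n. if buys r (sold ?v r t) (?v t) then base Z (place ?v r t) else 0)
          + (\<Sum>t<?n. gain ?v Z t r)"
      using F_le[OF r] sum_sold[where h = "\<lambda>y. base Z (pos (idx y) r)" and v = ?v and n = ?n and r = r] by simp
    also have "\<dots> \<le> cPPM k \<Delta> (\<phi>_star L U k q) q I r"
      unfolding cPPM_eq sum.distrib[symmetric]
      using base_gain_le[OF r _ _ reach] v by (intro sum_mono) auto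
    finally show ?thesis .
  qed
  have "((\<lambda>r. F r + (\<Sum>t<?n. gain ?v Z t r)) has_integral A + (\<Sum>t<?n. D t)) {0..1}"
    using F D by (intro has_integral_add has_integral_sum) auto
  then have "A + (\<Sum>t<?n. D t) \<le> (\<integral>r. cPPM k \<Delta> (\<phi>_star L U k q) q I r \<partial>seed)"
    using le by (rule has_integral_le[OF _ has_integral_seed[OF cPPM_measurable cPPM_bounds[OF I]]])
  moreover have "(\<Sum>t<?n. max 0 (I ! t - price Z)) / a \<le> (\<Sum>t<?n. D t)"
    unfolding sum_divide_distrib using D by (intro sum_mono) auto
  ultimately show ?thesis by simp
qed

section \<open>The flat and the steep case\<close>

lemma sum_base_sold:
  assumes r: "r \<in> {0..1}" and Z: "sold v r n < k \<Longrightarrow> Z \<le> place v r n"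
  shows "(\<Sum>y<sold v r n. base Z (pos (idx y) r))
    = (\<Sum>j\<in>{1..Suc \<Delta>}. real (q j) * base Z (pos j r))"
proof -
  have "(\<Sum>y<sold v r n. base Z (pos (idx y) r)) = (\<Sum>y<k. base Z (pos (idx y) r))"
  proof (rule sum.mono_neutral_left)
    show "\<forall>y\<in>{..<k} - {..<sold v r n}. base Z (pos (idx y) r) = 0"
    proof
      fix y assume y: "y \<in> {..<k} - {..<sold v r n}"
      then have less: "sold v r n \<le> y" "y < k" by auto
      \<comment> \<open>An unsold unit lies at or beyond the next one, hence at or beyond
        \<open>Z\<close>, where \<open>base\<close> vanishes.\<close>
      then have "place v r n \<le> pos (idx y) r"
        using idx_mono[of "sold v r n" y] idx_props(1)[of "sold v r n"] r
        by (intro pos_mono_idx) auto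
      then show "base Z (pos (idx y) r) = 0" using Z less by (simp add: base_def)
    qed
  qed (use sold_le_k[of v r n] in auto)
  then show ?thesis using sum_idx[of "\<lambda>j. base Z (pos j r)"] by simp
qed

text \<open>Places only move up, so each earlier price was also \<open>L\<close>, which no buyer
  refuses.\<close>

lemma sold_all_flat:
  assumes r: "r \<in> {0..1}" and v: "\<And>t. t < n \<Longrightarrow> L \<le> v t"
    and n: "sold v r n < k" "place v r n < 1 / a"
  shows "sold v r n = n"
proof -
  have "t \<le> n \<Longrightarrow> sold v r t = t" for t
  proof (induction t)
    case (Suc t)
    have "place v r t < 1 / a" using place_mono[OF r _ n(1), of t] n(2) Suc.prems by simp
    moreover have "sold v r t < k" using sold_mono[of t n v r] n(1) Suc.prems by simp
    ultimately have "buys r (sold v r t) (v t)"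
      using v[of t] Suc.prems by (simp add: buys_def price_flat)
    then show ?case using Suc by simp
  qed simp
  then show ?thesis by simp
qed

text \<open>If some seed serves all buyers below the flat end of the curve, then fewer than \<open>k\<close> buyers
  arrived, and each seed sells at least the fraction \<open>n / k\<close> of its flat units.\<close>

lemma competitive_flat:
  assumes I: "set I \<subseteq> {L..U}" and s: "s \<in> {0..1}"
    "sold (nth I) s (length I) < k" "place (nth I) s (length I) < 1 / a"
  shows "OPT k I / a \<le> (\<integral>r. cPPM k \<Delta> (\<phi>_star L U k q) q I r \<partial>seed)"
proof -
  let ?n = "length I" and ?v = "nth I"
  let ?F = "\<lambda>r. real ?n / real k * (\<Sum>j\<in>{1..Suc \<Delta>}. real (q j) * base (1 / a) (pos j r))"
  have v: "L \<le> I ! t" if "t < ?n" for t using nth_mem[OF that] I by fastforce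
  have n: "?n < k" using sold_all_flat[OF s(1) v s(2,3)] s(2) by simp
  have k: "real k > 0" using k_pos by simp
  have "(base (1 / a) has_integral L / a) {0..1}"
    using has_integral_base[of "1 / a"] inverse_a by (simp add: price_flat)
  then have F: "(?F has_integral real ?n / real k * (real k * (L / a))) {0..1}"
    by (intro has_integral_mult_right has_integral_batches)
  \<comment> \<open>A seed still in the flat part has sold \<open>n\<close> units at price
    \<open>L\<close>, while \<open>?F r\<close> is at most \<open>n * L\<close>. Any other seed has
    sold all its flat units, and the factor \<open>n / k\<close> is at most 1.\<close>
  have F_le: "?F r \<le> (\<Sum>y<sold ?v r ?n. base (1 / a) (pos (idx y) r))" if r: "r \<in> {0..1}" for r
  proof (cases "sold ?v r ?n < k \<and> place ?v r ?n < 1 / a")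
    case True
    then have n_eq: "sold ?v r ?n = ?n" by (intro sold_all_flat[OF r v]) auto
    have base: "base (1 / a) (pos (idx y) r) = L" if "y < ?n" for y
    proof -
      have "pos (idx y) r \<le> place ?v r ?n"
        using True n_eq that idx_mono[of y ?n] idx_props(1)[of y] r by (intro pos_mono_idx) auto
      then show ?thesis using True by (simp add: base_def price_flat)
    qed
    have "(\<Sum>j\<in>{1..Suc \<Delta>}. real (q j) * base (1 / a) (pos j r)) \<le> (\<Sum>j\<in>{1..Suc \<Delta>}. real (q j) * L)"
      using L_pos by (intro sum_mono mult_left_mono) (auto simp: base_def price_flat)
    also have "\<dots> = real k * L" using q_sum by (simp add: sum_distrib_right[symmetric] flip: of_nat_sum)
    finally have "?F r \<le> real ?n / real k * (real k * L)" by (intro mult_left_mono) auto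
    also have "\<dots> = (\<Sum>y<sold ?v r ?n. base (1 / a) (pos (idx y) r))"
      using k by (simp add: n_eq base)
    finally show ?thesis .
  next
    case False
    then have eq: "(\<Sum>y<sold ?v r ?n. base (1 / a) (pos (idx y) r))
        = (\<Sum>j\<in>{1..Suc \<Delta>}. real (q j) * base (1 / a) (pos j r))"
      using r by (intro sum_base_sold) auto
    have "?F r \<le> 1 * (\<Sum>j\<in>{1..Suc \<Delta>}. real (q j) * base (1 / a) (pos j r))"
      using n by (intro mult_right_mono sum_nonneg mult_nonneg_nonneg base_nonneg) auto
    then show ?thesis unfolding eq by simp
  qed
  \<comment> \<open>The seed \<open>s\<close> is a witness for every \<open>x\<close>, as its place
    is below \<open>1 / a\<close>.\<close>
  have reach: "\<exists>s\<in>{0..1}. sold ?v s ?n < k \<and> place ?v s ?n < x" if "1 / a < x" for x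
    using s that by (meson less_trans)
  have "OPT k I \<le> (\<Sum>t<?n. I ! t)" using I L_pos by (intro OPT_le_sum) fastforce
  also have "\<dots> = (\<Sum>t<?n. L + max 0 (I ! t - L))" using v by (intro sum.cong) auto
  also have "\<dots> = real ?n * L + (\<Sum>t<?n. max 0 (I ! t - L))" by (simp add: sum.distrib)
  finally have "OPT k I / a \<le> (real ?n * L + (\<Sum>t<?n. max 0 (I ! t - L))) / a"
    using a_ge_1 by (intro divide_right_mono) auto
  also have "\<dots> = real ?n / real k * (real k * (L / a)) + (\<Sum>t<?n. max 0 (I ! t - price (1 / a))) / a"
    using k by (simp add: add_divide_distrib price_flat)
  also have "\<dots> \<le> (\<integral>r. cPPM k \<Delta> (\<phi>_star L U k q) q I r \<partial>seed)"
    using expectation_ge[OF I order_refl reach F F_le] by simp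
  finally show ?thesis .
qed

lemma competitive_steep:
  assumes I: "set I \<subseteq> {L..U}"
    and steep: "\<And>s. s \<in> {0..1} \<Longrightarrow> sold (nth I) s (length I) < k \<Longrightarrow> 1 / a \<le> place (nth I) s (length I)"
  shows "OPT k I / a \<le> (\<integral>r. cPPM k \<Delta> (\<phi>_star L U k q) q I r \<partial>seed)"
proof -
  let ?n = "length I" and ?v = "nth I"
  define S where "S = {place ?v s ?n | s. s \<in> {0..1} \<and> sold ?v s ?n < k}"
  \<comment> \<open>Inserting 1 keeps the infimum meaningful when every seed is sold out. In
    \<open>reach\<close> the bound \<open>x \<le> 1\<close> ensures that an element below
    \<open>x\<close> comes from \<open>S\<close>.\<close>
  define Z where "Z = Inf (insert 1 S)"
  have lower: "1 / a \<le> x" if "x \<in> insert 1 S" for x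
    using that steep inverse_a by (auto simp: S_def)
  then have bdd: "bdd_below (insert 1 S)" by (rule bdd_belowI)
  have Z: "1 / a \<le> Z" unfolding Z_def using lower by (intro cInf_greatest) auto
  have Z1: "Z \<le> 1" unfolding Z_def using bdd by (intro cInf_lower) auto
  have ge: "Z \<le> place ?v s ?n" if "s \<in> {0..1}" "sold ?v s ?n < k" for s
    unfolding Z_def using bdd that by (intro cInf_lower) (auto simp: S_def)
  have reach: "\<exists>s\<in>{0..1}. sold ?v s ?n < k \<and> place ?v s ?n < x" if x: "Z < x" "x \<le> 1" for x
  proof -
    obtain y where "y \<in> insert 1 S" "y < x"
      using cInf_lessD[of "insert 1 S" x] x(1) unfolding Z_def by blast
    then show ?thesis using x(2) by (auto simp: S_def)
  qed
  have "OPT k I \<le> real k * price Z + (\<Sum>t<?n. max 0 (I ! t - price Z))"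
    using price_pos[of Z] by (intro OPT_le_threshold) simp
  then have "OPT k I / a \<le> (real k * price Z + (\<Sum>t<?n. max 0 (I ! t - price Z))) / a"
    using a_ge_1 by (intro divide_right_mono) auto
  also have "\<dots> = real k * (price Z / a) + (\<Sum>t<?n. max 0 (I ! t - price Z)) / a"
    by (simp add: add_divide_distrib)
  also have "\<dots> \<le> (\<integral>r. cPPM k \<Delta> (\<phi>_star L U k q) q I r \<partial>seed)"
    using sum_base_sold[OF _ ge]
    by (intro expectation_ge[OF I Z reach has_integral_batches[OF has_integral_base[OF Z Z1]]]) auto
  finally show ?thesis .
qed

lemma competitive: "CVaR_CR 1 L U k seed (cPPM k \<Delta> (\<phi>_star L U k q) q) \<le> ereal a"
  unfolding CVaR_CR_def
proof (rule SUP_least)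
  fix I assume "I \<in> instances L U"
  then have I: "I \<noteq> []" "set I \<subseteq> {L..U}" by (auto simp: instances_def)
  let ?E = "\<integral>r. cPPM k \<Delta> (\<phi>_star L U k q) q I r \<partial>seed"
  let ?c = "CVaR 1 seed (cPPM k \<Delta> (\<phi>_star L U k q) q I)"
  have a: "a > 0" using a_ge_1 by simp
  have "OPT k I > 0" using I k_pos L_pos by (intro OPT_pos) fastforce+
  \<comment> \<open>Either some seed with units left ends in the flat part, or none does.\<close>
  moreover have OPT: "OPT k I / a \<le> ?E"
    using competitive_flat[OF I(2)] competitive_steep[OF I(2)] by force
  ultimately have E: "?E > 0" using a by (meson divide_pos_pos less_le_trans)
  have c: "ereal ?E \<le> ?c" by (rule CVaR_1_ge_expectation[OF cPPM_measurable cPPM_bounds[OF I(2)]])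
  \<comment> \<open>If CVaR is \<infinity>, the quotient is 0; the value -\<infinity> contradicts
    the lower bound \<open>c\<close>.\<close>
  show "ereal (OPT k I) / ?c \<le> ereal a"
  proof (cases ?c)
    case (real c)
    then have c: "?E \<le> c" using c by simp
    have "OPT k I \<le> a * ?E" using OPT a by (simp add: pos_divide_le_eq mult.commute)
    also have "\<dots> \<le> a * c" using a c by (intro mult_left_mono) auto
    finally show ?thesis using real c E by (simp add: pos_divide_le_eq)
  qed (use c a in auto)
qed

end

theorem theorem1:
  fixes L U :: real and k \<Delta> :: nat and q :: "nat \<Rightarrow> nat"
  assumes "0 < L" and "L \<le> U"
    and "k \<ge> 1"
    and "\<Delta> \<in> {0..k - 1}"
    and "\<And>i j. i \<in> {1..\<Delta> + 1} \<Longrightarrow> j \<in> {1..\<Delta> + 1} \<Longrightarrow> i \<le> j \<Longrightarrow> q i \<le> q j"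
    and "(\<Sum>j\<in>{1..\<Delta> + 1}. q j) = k"
  shows "CVaR_CR 1 L U k seed (cPPM k \<Delta> (\<phi>_star L U k q) q) \<le> ereal (\<alpha>_star L U)"
proof -
  interpret price_curve L U k \<Delta> q
    using assms by unfold_locales
  show ?thesis using competitive by (simp add: a_def)
qed

end
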